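(* Let $n>1$ and $k>1$ be integers. In a sample of size $k$ (that is, $k$ independent and identically distributed random variables) from the distribution $Exp(1/\log n)$, let $y_k$ be the $(1-1/k)$-quantile of the maximal order statistic $X_{(k)}$ (the largest of the $k$ sample values). Then $$y_k\sim 2(\log n)(\log k)\qquad\text{as } k\to\infty .$$ If $k=k(n)$ depends on $n$ with $k\sim tn$ as $n\to\infty$ for some constant $t>0$, then $$y_k\sim 2(\log n)^2\qquad\text{as } n\to\infty .$$
   Context: For $\lambda>0$, $Exp(\lambda)$ is the exponential distribution with cumulative distribution function $F(x)=1-\exp(-\lambda x)$ for $x\ge0$ (mean $1/\lambda$), so $Exp(1/\log n)$ has mean $\log n$. For $0<q<1$, the $(1-q)$-quantile of $X_{(k)}$ is the number $y$ with $\Pr\{X_{(k)}>y\}=q$; here $q=1/k$. The notation $f\sim g$ means that $f/g\to1$. *)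

theory Defs
  imports "HOL-Probability.Probability" "HOL-Library.Landau_Symbols"
begin

text \<open>The parameter \<open>l\<close> is the rate, so the mean of each observation is \<open>1 / l\<close>.\<close>

definition exponential_sample ::
    "'a measure \<Rightarrow> real \<Rightarrow> nat \<Rightarrow> (nat \<Rightarrow> 'a \<Rightarrow> real) \<Rightarrow> bool" where
  "exponential_sample M l k X \<longleftrightarrow>
     prob_space M \<and>
     prob_space.indep_vars M (\<lambda>_. borel) X {1..k} \<and>
     (\<forall>i\<in>{1..k}. distributed M lborel (X i) (exponential_density l))"

definition sample_max :: "nat \<Rightarrow> (nat \<Rightarrow> 'a \<Rightarrow> real) \<Rightarrow> 'a \<Rightarrow> real" where
  "sample_max k X \<omega> = Max ((\<lambda>i. X i \<omega>) ` {1..k})"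

text \<open>The \<open>p\<close>-quantile is the number exceeded with probability \<open>1 - p\<close>. It is only specified
  when exactly one such number exists, so it is meant for random variables with a continuous
  distribution function that is strictly increasing where it lies strictly between 0 and 1.\<close>

definition quantile :: "'a measure \<Rightarrow> ('a \<Rightarrow> real) \<Rightarrow> real \<Rightarrow> real" where
  "quantile M Y p = (THE y. measure M {\<omega> \<in> space M. Y \<omega> > y} = 1 - p)"

end

theory Submission
  imports Defs "HOL-Real_Asymp.Real_Asymp"
begin

text \<open>Independence makes the distribution function of the maximum of \<open>k\<close> exponential variables
  of rate \<open>l\<close> equal to \<open>(1 - exp (- l x)) ^ k\<close> for \<open>x \<ge> 0\<close> and to \<open>0\<close> for \<open>x < 0\<close>. It is strictly
  increasing on the nonnegative reals, so every level \<open>p\<close> with \<open>0 < p < 1\<close> has exactly one quantile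
  (lemma \<open>quantile_sample_max_exponential\<close>), namely
  \<open>- ln (1 - p powr (1 / k)) / l\<close>. For \<open>p = 1 - 1 / k\<close> one has
  \<open>p powr (1 / k) = 1 - 1 / k\<^sup>2 + o(1 / k\<^sup>2)\<close>, so the numerator is asymptotic to
  \<open>- ln (1 / k\<^sup>2) = 2 ln k\<close>. With \<open>1 / l = ln n\<close> this is the first claim. Since the factor \<open>ln n\<close>
  does not interact with \<open>k\<close>, a sequence \<open>k \<sim> t n\<close> may be substituted, and then
  \<open>ln k = ln n + ln t + o(1) \<sim> ln n\<close>.\<close>

lemma sample_max_le_iff:
  assumes "k > 0"
  shows "sample_max k X \<omega> \<le> x \<longleftrightarrow> (\<forall>i\<in>{1..k}. X i \<omega> \<le> x)"
proof -
  have "(\<lambda>i. X i \<omega>) ` {1..k} \<noteq> {}"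
    using assms by auto
  then show ?thesis
    unfolding sample_max_def by (subst Max_le_iff) auto
qed

lemma prob_sample_max_exponential_le:
  assumes S: "exponential_sample M l k X" and l: "l > 0" and k: "k > 0" and x: "x \<ge> 0"
  shows "measure M {\<omega> \<in> space M. sample_max k X \<omega> \<le> x} = (1 - exp (- x * l)) ^ k"
proof -
  interpret prob_space M
    using S by (simp add: exponential_sample_def)
  have indep: "indep_vars (\<lambda>_. borel) X {1..k}"
    and dist: "\<And>i. i \<in> {1..k} \<Longrightarrow> distributed M lborel (X i) (exponential_density l)"
    using S by (auto simp: exponential_sample_def)
  have ne: "{1..k} \<noteq> {}"
    using k by auto
  have "{\<omega> \<in> space M. sample_max k X \<omega> \<le> x} = (\<Inter>i\<in>{1..k}. X i -` {..x} \<inter> space M)"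
    using ne by (auto simp: sample_max_le_iff[OF k])
  also have "prob \<dots> = (\<Prod>i\<in>{1..k}. prob (X i -` {..x} \<inter> space M))"
    by (rule indep_varsD_finite[OF indep ne]) auto
  also have "\<dots> = (\<Prod>i\<in>{1..k}. 1 - exp (- x * l))"
  proof (rule prod.cong[OF refl])
    fix i assume "i \<in> {1..k}"
    from exponential_distributedD_le[OF dist[OF this] x l]
    show "prob (X i -` {..x} \<inter> space M) = 1 - exp (- x * l)"
      by (simp add: vimage_def Int_def conj_commute)
  qed
  finally show ?thesis
    by simp
qed

lemma borel_measurable_sample_max:
  assumes S: "exponential_sample M l k X" and k: "k > 0"
  shows "sample_max k X \<in> borel_measurable M"
proof (rule borel_measurableI_le)
  fix x :: real
  have [measurable]: "X i \<in> borel_measurable M" if "i \<in> {1..k}" for i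
    using S that by (auto simp: exponential_sample_def distributed_def)
  show "{\<omega> \<in> space M. sample_max k X \<omega> \<le> x} \<in> sets M"
    unfolding sample_max_le_iff[OF k] by measurable
qed

lemma prob_sample_max_gt:
  assumes S: "exponential_sample M l k X" and k: "k > 0"
  shows "measure M {\<omega> \<in> space M. sample_max k X \<omega> > x} =
    1 - measure M {\<omega> \<in> space M. sample_max k X \<omega> \<le> x}"
proof -
  interpret prob_space M
    using S by (simp add: exponential_sample_def)
  have [measurable]: "sample_max k X \<in> borel_measurable M"
    using S k by (rule borel_measurable_sample_max)
  have "{\<omega> \<in> space M. sample_max k X \<omega> \<le> x} \<in> events"
    by measurable
  from prob_neg[OF this] show ?thesis
    by (simp add: not_le)
qed

text \<open>The defining equation of the quantile has exactly one solution here: at a negative argument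
  the maximum is exceeded almost surely, and \<open>(1 - exp (- x l)) ^ k = p\<close> can be solved
  explicitly for \<open>x \<ge> 0\<close>.\<close>

lemma quantile_sample_max_exponential:
  assumes S: "exponential_sample M l k X" and l: "l > 0" and k: "k > 0" and p: "0 < p" "p < 1"
  shows "quantile M (sample_max k X) p = - ln (1 - p powr (1 / real k)) / l"
proof -
  interpret prob_space M
    using S by (simp add: exponential_sample_def)
  define r where "r = p powr (1 / real k)"
  have r: "0 < r" "r < 1"
    using p k powr_less_mono2[of "1 / real k" p 1] by (auto simp: r_def)
  have rk: "r ^ k = p"
    using p k by (simp add: r_def powr_powr flip: powr_realpow)
  define z where "z = - ln (1 - r) / l"
  have z: "z \<ge> 0"
    using r l by (simp add: z_def field_simps)
  have zl: "exp (- z * l) = 1 - r"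
    using r l by (simp add: z_def)
  have iff: "measure M {\<omega> \<in> space M. sample_max k X \<omega> > x} = 1 - p \<longleftrightarrow> x = z" for x
  proof (cases "x \<ge> 0")
    case True
    have "measure M {\<omega> \<in> space M. sample_max k X \<omega> > x} = 1 - p \<longleftrightarrow> (1 - exp (- x * l)) ^ k = r ^ k"
      using prob_sample_max_gt[OF S k] prob_sample_max_exponential_le[OF S l k True]
      by (simp add: rk)
    also have "\<dots> \<longleftrightarrow> 1 - exp (- x * l) = r"
      using r l k True by (intro power_eq_iff_eq_base) auto
    also have "\<dots> \<longleftrightarrow> exp (- x * l) = exp (- z * l)"
      unfolding zl by auto
    also have "\<dots> \<longleftrightarrow> x = z"
      using l by simp
    finally show ?thesis .
  next
    case False
    \<comment> \<open>Exceeding \<open>0\<close> already has probability \<open>1\<close>, which differs from \<open>1 - p\<close>.\<close>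
    have "measure M {\<omega> \<in> space M. sample_max k X \<omega> > 0} = 1"
      using prob_sample_max_gt[OF S k] prob_sample_max_exponential_le[OF S l k order_refl] k
      by simp
    moreover have "measure M {\<omega> \<in> space M. sample_max k X \<omega> > x} \<ge>
        measure M {\<omega> \<in> space M. sample_max k X \<omega> > 0}"
    proof (rule finite_measure_mono)
      have [measurable]: "sample_max k X \<in> borel_measurable M"
        using S k by (rule borel_measurable_sample_max)
      show "{\<omega> \<in> space M. sample_max k X \<omega> > x} \<in> events"
        by measurable
    qed (use False in auto)
    ultimately show ?thesis
      using p z False by auto
  qed
  show ?thesis
    unfolding quantile_def iff by (simp add: z_def r_def)
qed

lemma ln_one_minus_powr_asymp_equiv:
  "(\<lambda>k. - ln (1 - (1 - 1 / real k) powr (1 / real k))) \<sim>[at_top] (\<lambda>k. 2 * ln (real k))"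
  by real_asymp

lemma filterlim_nat_asymp_linear:
  fixes \<kappa> :: "nat \<Rightarrow> nat"
  assumes "(\<lambda>n. real (\<kappa> n)) \<sim>[at_top] (\<lambda>n. t * real n)" and "t > 0"
  shows "filterlim \<kappa> at_top at_top"
proof -
  have "filterlim (\<lambda>n. t * real n) at_top at_top"
    using \<open>t > 0\<close> by real_asymp
  then have "filterlim (\<lambda>n. real (\<kappa> n)) at_top at_top"
    using asymp_equiv_at_top_transfer[OF asymp_equiv_symI[OF assms(1)]] by blast
  then show ?thesis
    by (simp add: filterlim_sequentially_iff_filterlim_real)
qed

lemma ln_asymp_equiv_of_asymp_linear:
  fixes \<kappa> :: "nat \<Rightarrow> nat"
  assumes equiv: "(\<lambda>n. real (\<kappa> n)) \<sim>[at_top] (\<lambda>n. t * real n)" and t: "t > 0"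
  shows "(\<lambda>n. ln (real (\<kappa> n))) \<sim>[at_top] (\<lambda>n. ln (real n))"
proof -
  have "((\<lambda>n. real (\<kappa> n) / (t * real n)) \<longlongrightarrow> 1) at_top"
    using equiv
    by (rule asymp_equivD_strong) (use t in \<open>auto intro!: eventually_mono[OF eventually_gt_at_top[of 0]]\<close>)
  then have "((\<lambda>n. ln (real (\<kappa> n) / (t * real n))) \<longlongrightarrow> ln 1) at_top"
    by (rule tendsto_ln) simp
  \<comment> \<open>For large \<open>n\<close> the function below is \<open>ln (\<kappa> n) / ln n\<close>,
    since \<open>\<kappa> n = n * t * (\<kappa> n / (t * n))\<close>.\<close>
  then have "((\<lambda>n. 1 + (ln (real (\<kappa> n) / (t * real n)) + ln t) * (1 / ln (real n)))
      \<longlongrightarrow> 1 + (ln 1 + ln t) * 0) at_top"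
    by (rule tendsto_add[OF tendsto_const tendsto_mult[OF tendsto_add[OF _ tendsto_const]]]) real_asymp
  then have "((\<lambda>n. 1 + (ln (real (\<kappa> n) / (t * real n)) + ln t) * (1 / ln (real n))) \<longlongrightarrow> 1) at_top"
    by simp
  moreover have "eventually (\<lambda>n. \<kappa> n > 0) at_top"
    using filterlim_nat_asymp_linear[OF equiv t] eventually_gt_at_top[of 0]
    by (rule eventually_compose_filterlim[rotated])
  then have "eventually (\<lambda>n. 1 + (ln (real (\<kappa> n) / (t * real n)) + ln t) * (1 / ln (real n)) =
      ln (real (\<kappa> n)) / ln (real n)) at_top"
    using eventually_gt_at_top[of 1]
    by eventually_elim (use t in \<open>simp add: ln_div ln_mult field_simps\<close>)
  ultimately have "((\<lambda>n. ln (real (\<kappa> n)) / ln (real n)) \<longlongrightarrow> 1) at_top"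
    by (rule Lim_transform_eventually)
  then show ?thesis
    by (rule asymp_equivI')
qed

theorem theorem7:
  fixes M :: "nat \<Rightarrow> nat \<Rightarrow> 'a measure"
    and X :: "nat \<Rightarrow> nat \<Rightarrow> nat \<Rightarrow> 'a \<Rightarrow> real"
    and y :: "nat \<Rightarrow> nat \<Rightarrow> real"
  assumes sample: "\<And>n k. n > 1 \<Longrightarrow> k > 1 \<Longrightarrow>
      exponential_sample (M n k) (1 / ln (real n)) k (X n k)"
    and y: "\<And>n k. n > 1 \<Longrightarrow> k > 1 \<Longrightarrow>
      y n k = quantile (M n k) (sample_max k (X n k)) (1 - 1 / real k)"
  shows "(\<forall>n>1. (\<lambda>k. y n k) \<sim>[at_top] (\<lambda>k. 2 * ln (real n) * ln (real k))) \<and>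
    (\<forall>t>0. \<forall>\<kappa>. (\<lambda>n. real (\<kappa> n)) \<sim>[at_top] (\<lambda>n. t * real n) \<longrightarrow>
      (\<lambda>n. y n (\<kappa> n)) \<sim>[at_top] (\<lambda>n. 2 * (ln (real n))\<^sup>2))"
proof -
  define q where "q k = - ln (1 - (1 - 1 / real k) powr (1 / real k))" for k :: nat
  have q: "q \<sim>[at_top] (\<lambda>k. 2 * ln (real k))"
    unfolding q_def by (rule ln_one_minus_powr_asymp_equiv)
  have y_eq: "y n k = ln (real n) * q k" if "n > 1" "k > 1" for n k
    using quantile_sample_max_exponential[OF sample[OF that], of "1 - 1 / real k"] y[OF that] that
    by (simp add: q_def)
  have "(\<lambda>k. y n k) \<sim>[at_top] (\<lambda>k. 2 * ln (real n) * ln (real k))" if n: "n > 1" for n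
  proof -
    have "(\<lambda>k. ln (real n) * q k) \<sim>[at_top] (\<lambda>k. ln (real n) * (2 * ln (real k)))"
      by (intro asymp_equiv_intros q)
    moreover have "eventually (\<lambda>k. ln (real n) * q k = y n k) at_top"
      using eventually_gt_at_top[of 1] by eventually_elim (use n y_eq in auto)
    ultimately show ?thesis
      by (rule asymp_equiv_transfer) (simp add: mult_ac)
  qed
  moreover have "(\<lambda>n. y n (\<kappa> n)) \<sim>[at_top] (\<lambda>n. 2 * (ln (real n))\<^sup>2)"
    if t: "t > 0" and equiv: "(\<lambda>n. real (\<kappa> n)) \<sim>[at_top] (\<lambda>n. t * real n)" for t \<kappa>
  proof -
    have lim: "filterlim \<kappa> at_top at_top"
      using equiv t by (rule filterlim_nat_asymp_linear)
    have "(\<lambda>n. ln (real n) * q (\<kappa> n)) \<sim>[at_top] (\<lambda>n. ln (real n) * (2 * ln (real (\<kappa> n))))"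
      by (intro asymp_equiv_intros asymp_equiv_compose'[OF q lim])
    also have "\<dots> \<sim>[at_top] (\<lambda>n. ln (real n) * (2 * ln (real n)))"
      by (intro asymp_equiv_intros ln_asymp_equiv_of_asymp_linear[OF equiv t])
    finally have "(\<lambda>n. ln (real n) * q (\<kappa> n)) \<sim>[at_top] (\<lambda>n. 2 * (ln (real n))\<^sup>2)"
      by (simp add: power2_eq_square mult_ac)
    moreover have "eventually (\<lambda>n. \<kappa> n > 1) at_top"
      using eventually_gt_at_top[of 1] lim by (rule eventually_compose_filterlim)
    then have "eventually (\<lambda>n. ln (real n) * q (\<kappa> n) = y n (\<kappa> n)) at_top"
      using eventually_gt_at_top[of 1] by eventually_elim (simp add: y_eq)
    ultimately show ?thesis
      by (rule asymp_equiv_transfer) simp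
  qed
  ultimately show ?thesis
    by blast
qed

end
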